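(* Let $\tilde\rho=\rho+\alpha\dot m^*_t-g$. In the collective (Nash) bargaining problem described in the context, the real wage under collective bargaining is given by $$w^u_t=b_t+\Psi^u_t\left[y_{L_t}-b_t+\frac{\rho+\alpha\dot m^*_t-g+\lambda_t}{\rho+\alpha\dot m^*_t-g}\,\big(\hat y_t-y_{L_t}\big)\right],$$ with $$\Psi^u_t=\frac{\Gamma^u\,[\rho+\alpha\dot m^*_t-g+\lambda_t+f(\theta_t)]}{\rho+\alpha\dot m^*_t-g+\lambda_t+\Gamma^uf(\theta_t)}.$$
   Context: $\theta$ is the vacancy-unemployment ratio, $f(\theta)>0$ the job-finding rate, $q(\theta)>0$ the vacancy-filling rate, $\lambda>0$ the job separation rate, $\rho$ the discount rate, $g$ the growth rate, $\alpha>0$ a productivity parameter, $\dot m^*$ the rate of change of the automation measure, and $\tilde\rho=\rho+\alpha\dot m^*-g>0$. $L>0$ is employment, $y$ stationary output, $\hat y=y/L$ output per worker, $y_L$ the marginal product of labor, $b$ the flow value of unemployment, $\xi$ the flow cost of a vacancy, and $\Gamma^u\in(0,1)$ the intrinsic bargaining power of labor under collective bargaining. Stationary value functions: at wage $w$, the values of employment $\phi_L$ and unemployment $\phi_U$ satisfy $$\tilde\rho\,\phi_L=w+\lambda(\phi_U-\phi_L),\qquad \tilde\rho\,\phi_U=b+f(\theta)(\phi_L-\phi_U).$$ The value to the firm of a marginal filled job satisfies $\tilde\rho\,\pi_L=y_L-w-\lambda\pi_L$ (the value of an unfilled vacancy is zero, so $\pi_L=\xi/q(\theta)$). The value of the firm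 as a whole, $\pi^L$, satisfies $$\tilde\rho\,\pi^L=y-wL-\frac{\lambda\xi L}{q(\theta)}=y-wL-\lambda\pi_LL .$$ Collective bargaining: if an agreement is reached the workers jointly receive $L(\phi_L-\phi_U)$ and the firm receives $\pi^L$; otherwise the firm loses all its workers. The wage solves the Nash bargaining problem $$\max_w\;\big(L(\phi_L-\phi_U)\big)^{\Gamma^u}\big(\pi^L\big)^{1-\Gamma^u},$$ where $\phi_U$ is taken as given in the maximization, $\pi_L$ is regarded as the function of $w$ determined by its equation above, and $L,\theta,y,y_L$ are given; the equation for $\phi_U$ then holds at the resulting wage. *)

theory Defs
  imports Complex_Main
begin

text \<open>
  Throughout, \<open>rt\<close> is the effective discount rate (rho tilde), \<open>lam\<close> the separation rate,
  \<open>yL\<close> the marginal product of labor, \<open>phiL\<close> and \<open>phiU\<close> the values of employment and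
  unemployment, \<open>b\<close> the flow value of unemployment, \<open>jfr\<close> the job-finding rate \<open>f theta\<close>,
  \<open>Gam\<close> the bargaining power of labor, \<open>piL\<close> the value of a marginal filled job, and \<open>piF\<close> the value of the whole firm.
\<close>

definition employment_eq :: "real \<Rightarrow> real \<Rightarrow> real \<Rightarrow> real \<Rightarrow> real \<Rightarrow> bool" where
  "employment_eq rt lam w phiL phiU \<longleftrightarrow> rt * phiL = w + lam * (phiU - phiL)"

definition unemployment_eq :: "real \<Rightarrow> real \<Rightarrow> real \<Rightarrow> real \<Rightarrow> real \<Rightarrow> bool" where
  "unemployment_eq rt b jfr phiL phiU \<longleftrightarrow> rt * phiU = b + jfr * (phiL - phiU)"

definition marginal_job_eq :: "real \<Rightarrow> real \<Rightarrow> real \<Rightarrow> real \<Rightarrow> real \<Rightarrow> bool" where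
  "marginal_job_eq rt lam yL w piL \<longleftrightarrow> rt * piL = yL - w - lam * piL"

definition firm_eq :: "real \<Rightarrow> real \<Rightarrow> real \<Rightarrow> real \<Rightarrow> real \<Rightarrow> real \<Rightarrow> real \<Rightarrow> bool" where
  "firm_eq rt lam L y w piL piF \<longleftrightarrow> rt * piF = y - w * L - lam * piL * L"

text \<open>
  The agreements \<open>(w, phiL, piF)\<close> open to the two parties when \<open>phiU\<close> is given. The value
  \<open>piL\<close> moves with \<open>w\<close>; it is not held at its equilibrium level. For \<open>rt > 0\<close> and \<open>lam > 0\<close>
  the equations determine \<open>phiL\<close>, \<open>piL\<close> and \<open>piF\<close> from \<open>w\<close>. Both disagreement payoffs are zero,
  so the Nash problem ranges over the agreements where neither payoff is negative; this is also
  where the real powers in the Nash product have their usual meaning.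
\<close>

definition agreements ::
    "real \<Rightarrow> real \<Rightarrow> real \<Rightarrow> real \<Rightarrow> real \<Rightarrow> real \<Rightarrow> (real \<times> real \<times> real) set" where
  "agreements rt lam L y yL phiU =
     {(w, phiL, piF). employment_eq rt lam w phiL phiU \<and>
        (\<exists>piL. marginal_job_eq rt lam yL w piL \<and> firm_eq rt lam L y w piL piF) \<and>
        0 \<le> L * (phiL - phiU) \<and> 0 \<le> piF}"

definition nash_product :: "real \<Rightarrow> real \<Rightarrow> real \<Rightarrow> real \<times> real \<times> real \<Rightarrow> real" where
  "nash_product Gam L phiU =
     (\<lambda>(w, phiL, piF). (L * (phiL - phiU)) powr Gam * piF powr (1 - Gam))"

definition collective_bargaining_wage ::
    "real \<Rightarrow> real \<Rightarrow> real \<Rightarrow> real \<Rightarrow> real \<Rightarrow> real \<Rightarrow> real \<Rightarrow> real \<Rightarrow> bool" where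
  "collective_bargaining_wage Gam rt lam L y yL phiU w \<longleftrightarrow>
     (\<exists>phiL piF. is_arg_max (nash_product Gam L phiU)
        (\<lambda>x. x \<in> agreements rt lam L y yL phiU) (w, phiL, piF))"

end

theory Submission
  imports Defs
begin

text \<open>
  With \<open>s = rt + lam\<close>, \<open>D = rt * phiU\<close> and \<open>M = yL + s / rt * (y / L - yL)\<close>, the value
  equations give the workers the surplus \<open>L * (w - D) / s\<close> and the firm \<open>L * (M - w) / s\<close>: the wage only transfers
  surplus, one for one. Weighted AM-GM therefore makes \<open>w = D + Gam * (M - D)\<close> the unique
  maximizer, and eliminating \<open>D\<close> with the equation for \<open>phiU\<close> gives the wage formula.
\<close>

text \<open>Strict weighted AM-GM, normalised to mean one: take logarithms and use
  \<open>ln x <= x - 1\<close>, which is strict for \<open>x \<noteq> 1\<close>. Strictness at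
  \<open>a\<close> alone is enough because its weight \<open>G\<close> is positive.\<close>

lemma weighted_powr_prod_less_one:
  fixes a c G :: real
  assumes "0 < a" "0 < c" "0 < G" "G < 1" "G * a + (1 - G) * c = 1" "a \<noteq> 1"
  shows "a powr G * c powr (1 - G) < 1"
proof -
  have "ln a < a - 1"
    using assms ln_le_minus_one[of a] ln_eq_minus_one[of a] by linarith
  then have "G * ln a < G * (a - 1)"
    using assms by simp
  moreover have "(1 - G) * ln c \<le> (1 - G) * (c - 1)"
    using assms ln_le_minus_one[of c] by (intro mult_left_mono) auto
  ultimately have "G * ln a + (1 - G) * ln c < 0"
    using assms(5) by (simp add: algebra_simps)
  moreover have "a powr G * c powr (1 - G) = exp (G * ln a + (1 - G) * ln c)"
    using assms by (simp add: powr_def exp_add)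
  ultimately show ?thesis
    by simp
qed

text \<open>Since \<open>v\<close> cuts the segment from \<open>D\<close> to \<open>M\<close> in the
  ratio \<open>G : 1 - G\<close>, dividing each factor at \<open>w\<close> by the same factor at
  \<open>v\<close> gives two ratios whose weighted mean is one.\<close>

lemma weighted_powr_split_less:
  fixes D M G v w :: real
  assumes G: "0 < G" "G < 1" and w: "D \<le> w" "w \<le> M"
    and v: "v = D + G * (M - D)" and "w \<noteq> v"
  shows "(w - D) powr G * (M - w) powr (1 - G) < (v - D) powr G * (M - v) powr (1 - G)"
proof -
  have "D < M"
    using w v \<open>w \<noteq> v\<close> by (cases "D = M") auto
  have vD: "v - D = G * (M - D)" and Mv: "M - v = (1 - G) * (M - D)"
    by (simp_all add: v algebra_simps)
  have pos: "0 < v - D" "0 < M - v"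
    unfolding vD Mv using G \<open>D < M\<close> by simp_all
  show ?thesis
  \<comment> \<open>At an endpoint one ratio is zero and has no usable logarithm, but there the left
    product vanishes while the right one is positive.\<close>
  proof (cases "w = D \<or> w = M")
    case True
    then show ?thesis
      using pos by auto
  next
    case False
    define a c where "a = (w - D) / (v - D)" and "c = (M - w) / (M - v)"
    have ac: "0 < a" "0 < c"
      using False w pos by (simp_all add: a_def c_def)
    have "G * a + (1 - G) * c = (w - D) / (M - D) + (M - w) / (M - D)"
      unfolding a_def c_def vD Mv using G by simp
    also have "\<dots> = 1"
      using \<open>D < M\<close> by (simp flip: add_divide_distrib)
    finally have "a powr G * c powr (1 - G) < 1"
      using ac G pos \<open>w \<noteq> v\<close> by (intro weighted_powr_prod_less_one) (auto simp: a_def)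
    moreover have "w - D = a * (v - D)" "M - w = c * (M - v)"
      using pos by (simp_all add: a_def c_def)
    then have "(w - D) powr G * (M - w) powr (1 - G) =
        (a powr G * c powr (1 - G)) * ((v - D) powr G * (M - v) powr (1 - G))"
      using ac pos by (simp add: powr_mult)
    ultimately show ?thesis
      using pos by simp
  qed
qed

text \<open>The wage at which \<open>phiL = phiU\<close>, so that workers gain nothing from an
  agreement.\<close>

definition reservation_wage :: "real \<Rightarrow> real \<Rightarrow> real" where
  "reservation_wage rt phiU = rt * phiU"

text \<open>The wage at which the whole firm is worth zero once \<open>piL\<close> has adjusted to
  it.\<close>

definition break_even_wage :: "real \<Rightarrow> real \<Rightarrow> real \<Rightarrow> real \<Rightarrow> real \<Rightarrow> real" where
  "break_even_wage rt lam L y yL = yL + (rt + lam) / rt * (y / L - yL)"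

lemma employment_eq_iff:
  assumes "rt > 0" "lam > 0"
  shows "employment_eq rt lam w phiL phiU \<longleftrightarrow>
    phiL - phiU = (w - reservation_wage rt phiU) / (rt + lam)"
  using assms by (simp add: employment_eq_def reservation_wage_def eq_divide_eq) argo

lemma marginal_job_eq_iff:
  assumes "rt > 0" "lam > 0"
  shows "marginal_job_eq rt lam yL w piL \<longleftrightarrow> piL = (yL - w) / (rt + lam)"
  using assms by (simp add: marginal_job_eq_def eq_divide_eq) argo

text \<open>A higher wage also lowers \<open>piL\<close> and with it the replacement cost
  \<open>lam * piL * L\<close>, so flow profit falls in \<open>w\<close> only at rate
  \<open>rt * L / (rt + lam)\<close>. Dividing by \<open>rt\<close> leaves the slope
  \<open>- L / (rt + lam)\<close>, the opposite of the slope of the workers' surplus.\<close>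

lemma firm_eq_iff:
  assumes "rt > 0" "lam > 0" "L > 0"
  shows "firm_eq rt lam L y w ((yL - w) / (rt + lam)) piF \<longleftrightarrow>
    piF = L * (break_even_wage rt lam L y yL - w) / (rt + lam)"
proof -
  have "y - w * L - lam * ((yL - w) / (rt + lam)) * L =
      L * (y / L - w - lam * ((yL - w) / (rt + lam)))"
    using assms by (simp add: left_diff_distrib right_diff_distrib mult.commute[of L])
  also have "y / L - w - lam * ((yL - w) / (rt + lam)) =
      ((rt + lam) * (y / L - w) - lam * (yL - w)) / (rt + lam)"
    using assms by (simp add: diff_divide_distrib right_diff_distrib)
  also have "(rt + lam) * (y / L - w) - lam * (yL - w) = (rt + lam) * (y / L) - lam * yL - rt * w"
    by (simp add: algebra_simps)
  \<comment> \<open>Writing \<open>- lam * yL\<close> as \<open>rt * yL - (rt + lam) * yL\<close>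
    prepares for factoring out \<open>rt\<close>.\<close>
  also have "(rt + lam) * (y / L) - lam * yL = rt * yL + (rt + lam) * (y / L - yL)"
    by (simp add: algebra_simps)
  also have "\<dots> = rt * break_even_wage rt lam L y yL"
    using assms by (simp add: break_even_wage_def distrib_left)
  finally have "y - w * L - lam * ((yL - w) / (rt + lam)) * L =
      rt * (L * (break_even_wage rt lam L y yL - w) / (rt + lam))"
    by (simp add: algebra_simps)
  then show ?thesis
    unfolding firm_eq_def using assms by (metis mult_left_cancel less_irrefl)
qed

lemma agreements_iff:
  assumes "rt > 0" "lam > 0" "L > 0"
  shows "(w, phiL, piF) \<in> agreements rt lam L y yL phiU \<longleftrightarrow>
    phiL - phiU = (w - reservation_wage rt phiU) / (rt + lam) \<and>
    piF = L * (break_even_wage rt lam L y yL - w) / (rt + lam) \<and>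
    reservation_wage rt phiU \<le> w \<and> w \<le> break_even_wage rt lam L y yL"
proof -
  have "phiU \<le> phiL \<longleftrightarrow> reservation_wage rt phiU \<le> w"
    if "phiL - phiU = (w - reservation_wage rt phiU) / (rt + lam)"
  proof -
    have "0 \<le> phiL - phiU \<longleftrightarrow> reservation_wage rt phiU \<le> w"
      unfolding that using assms by (simp add: zero_le_divide_iff)
    then show ?thesis
      by simp
  qed
  then show ?thesis
    unfolding agreements_def using assms
    by (auto simp: employment_eq_iff marginal_job_eq_iff firm_eq_iff
        zero_le_mult_iff zero_le_divide_iff)
qed

text \<open>Both payoffs carry the factor \<open>L / (rt + lam)\<close>, and the exponents add up to
  one, so it leaves the product as a positive constant without effect on the maximizer.\<close>

lemma nash_product_agreement:
  assumes "rt > 0" "lam > 0" "L > 0"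
    and "(w, phiL, piF) \<in> agreements rt lam L y yL phiU"
  shows "nash_product Gam L phiU (w, phiL, piF) = L / (rt + lam) *
    ((w - reservation_wage rt phiU) powr Gam * (break_even_wage rt lam L y yL - w) powr (1 - Gam))"
proof -
  define k where "k = L / (rt + lam)"
  define D M where "D = reservation_wage rt phiU" and "M = break_even_wage rt lam L y yL"
  have "k > 0"
    using assms by (simp add: k_def)
  have "L * (phiL - phiU) = k * (w - D)" "piF = k * (M - w)" "D \<le> w" "w \<le> M"
    using assms by (simp_all add: agreements_iff k_def D_def M_def)
  then have "nash_product Gam L phiU (w, phiL, piF) =
      (k powr Gam * k powr (1 - Gam)) * ((w - D) powr Gam * (M - w) powr (1 - Gam))"
    using \<open>k > 0\<close> unfolding nash_product_def prod.case by (simp only: powr_mult) simp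
  also have "k powr Gam * k powr (1 - Gam) = k"
    using \<open>k > 0\<close> by (simp flip: powr_add)
  finally show ?thesis
    by (simp add: k_def D_def M_def)
qed

text \<open>The wage parametrises the agreements by the segment from \<open>D\<close> to
  \<open>M\<close>, which reduces the problem to one variable. The condition \<open>D <= M\<close>
  says that this segment is nonempty; otherwise there is no maximizer.\<close>

lemma collective_bargaining_wage_iff:
  assumes params: "rt > 0" "lam > 0" "L > 0" and Gam: "0 < Gam" "Gam < 1"
    and D: "D = reservation_wage rt phiU" and M: "M = break_even_wage rt lam L y yL"
  shows "collective_bargaining_wage Gam rt lam L y yL phiU w \<longleftrightarrow>
    D \<le> M \<and> w = D + Gam * (M - D)"
proof -
  define h where "h u = (u - D) powr Gam * (M - u) powr (1 - Gam)" for u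
  define v where "v = D + Gam * (M - D)"
  define A where "A = agreements rt lam L y yL phiU"
  define agr where
    "agr u = (u, phiU + (u - D) / (rt + lam), L * (M - u) / (rt + lam))" for u
  have A_iff: "x \<in> A \<longleftrightarrow> (\<exists>u. x = agr u \<and> D \<le> u \<and> u \<le> M)" for x
    using params
    by (cases x) (auto simp: A_def agr_def agreements_iff simp flip: D M)
  have nash: "nash_product Gam L phiU (agr u) = L / (rt + lam) * h u"
    if "D \<le> u" "u \<le> M" for u
  proof -
    have "agr u \<in> A"
      using that A_iff by blast
    then show ?thesis
      using nash_product_agreement[OF params] by (simp add: A_def agr_def h_def D M)
  qed
  have nash_less: "nash_product Gam L phiU (agr u) < nash_product Gam L phiU (agr u') \<longleftrightarrow> h u < h u'"
    if "D \<le> u" "u \<le> M" "D \<le> u'" "u' \<le> M" for u u'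
    using that params by (simp add: nash divide_strict_right_mono divide_less_cancel)
  \<comment> \<open>The existential over \<open>phiL\<close> and \<open>piF\<close> disappears
    because \<open>agr w\<close> is the only possible agreement at wage \<open>w\<close>.\<close>
  have "collective_bargaining_wage Gam rt lam L y yL phiU w \<longleftrightarrow>
      is_arg_max (nash_product Gam L phiU) (\<lambda>x. x \<in> A) (agr w)"
    by (auto simp: collective_bargaining_wage_def is_arg_max_def A_iff simp flip: A_def)
       (auto simp: agr_def)
  also have "\<dots> \<longleftrightarrow> D \<le> w \<and> w \<le> M \<and> (\<forall>u. D \<le> u \<and> u \<le> M \<longrightarrow> \<not> h w < h u)"
  proof -
    have "agr w \<in> A \<longleftrightarrow> D \<le> w \<and> w \<le> M"
      by (auto simp: A_iff) (auto simp: agr_def)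
    then show ?thesis
      unfolding is_arg_max_def using nash_less by (metis A_iff)
  qed
  also have "\<dots> \<longleftrightarrow> D \<le> M \<and> w = v"
  proof -
    \<comment> \<open>The strict inequality gives both that \<open>v\<close> is a maximizer and that
      no other wage is.\<close>
    have best: "h u < h v" if "D \<le> u" "u \<le> M" "u \<noteq> v" for u
      unfolding h_def using Gam that v_def by (intro weighted_powr_split_less) auto
    have "D \<le> v" "v \<le> M" if "D \<le> M"
    proof -
      show "D \<le> v"
        using that Gam by (simp add: v_def)
      have "Gam * (M - D) \<le> 1 * (M - D)"
        using that Gam by (intro mult_right_mono) auto
      then show "v \<le> M"
        by (simp add: v_def)
    qed
    then show ?thesis
      using best by (metis less_asym less_irrefl order_trans)
  qed
  finally show ?thesis
    by (simp add: v_def)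
qed

text \<open>The outside option \<open>D\<close> itself depends on \<open>w\<close>: it is the mean
  of \<open>b\<close> and \<open>w\<close> with weights \<open>s\<close> and \<open>F\<close>.
  Eliminating it changes the coefficient of \<open>w\<close> from \<open>s + F\<close> to
  \<open>(s + F) - (1 - G) * F = s + G * F\<close>, the denominator of the formula.\<close>

lemma bargained_wage_iff:
  fixes s F G D M b w :: real
  assumes "s > 0" "F > 0" "G > 0" and D: "D = b + F * ((w - D) / s)"
  shows "w = D + G * (M - D) \<longleftrightarrow> w = b + G * (s + F) / (s + G * F) * (M - b)"
proof -
  have pos: "s + F > 0" "s + G * F > 0"
    using assms by (simp_all add: add_pos_pos)
  have "D * s = b * s + F * (w - D)"
    using D \<open>s > 0\<close> by (simp add: field_simps)
  then have Dw: "(s + F) * D = s * b + F * w"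
    by (simp add: algebra_simps)
  \<comment> \<open>After this scaling \<open>D\<close> occurs only in \<open>(s + F) * D\<close>,
    which \<open>Dw\<close> replaces.\<close>
  have "w = D + G * (M - D) \<longleftrightarrow> (s + F) * w = (s + F) * (D + G * (M - D))"
    using pos by simp
  also have "(s + F) * (D + G * (M - D)) = (1 - G) * ((s + F) * D) + G * (s + F) * M"
    by (simp add: algebra_simps)
  also have "(s + F) * w = (1 - G) * ((s + F) * D) + G * (s + F) * M \<longleftrightarrow>
      (w - b) * (s + G * F) = G * (s + F) * (M - b)"
    unfolding Dw by (simp add: algebra_simps)
  also have "\<dots> \<longleftrightarrow> w - b = G * (s + F) * (M - b) / (s + G * F)"
    using pos by (simp add: eq_divide_eq)
  also have "\<dots> \<longleftrightarrow> w = b + G * (s + F) / (s + G * F) * (M - b)"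
    by (simp add: algebra_simps)
  finally show ?thesis .
qed

theorem proposition2:
  fixes f q :: "real \<Rightarrow> real"
    and theta lam rho g alpha mdot rt L y yhat yL b xi Gam Psi :: real
    and w phiL phiU piL piF :: real
  assumes f_pos: "f theta > 0" and q_pos: "q theta > 0"
    and lam_pos: "lam > 0" and alpha_pos: "alpha > 0"
    and rt_def: "rt = rho + alpha * mdot - g" and rt_pos: "rt > 0"
    and L_pos: "L > 0" and yhat_def: "yhat = y / L"
    and Gam: "0 < Gam" "Gam < 1"
    and employment: "employment_eq rt lam w phiL phiU"
    and unemployment: "unemployment_eq rt b (f theta) phiL phiU"
    and marginal_job: "marginal_job_eq rt lam yL w piL"
    and free_entry: "piL = xi / q theta"
    and firm: "firm_eq rt lam L y w piL piF"
    and Psi_def: "Psi = Gam * (rho + alpha * mdot - g + lam + f theta) /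
                        (rho + alpha * mdot - g + lam + Gam * f theta)"
  shows "(collective_bargaining_wage Gam rt lam L y yL phiU w \<longrightarrow>
            w = b + Psi * (yL - b + (rho + alpha * mdot - g + lam) / (rho + alpha * mdot - g)
                                    * (yhat - yL)))
       \<and> (w = b + Psi * (yL - b + (rho + alpha * mdot - g + lam) / (rho + alpha * mdot - g)
                                    * (yhat - yL))
            \<and> 0 \<le> L * (phiL - phiU) \<and> 0 \<le> piF \<longrightarrow>
          collective_bargaining_wage Gam rt lam L y yL phiU w)"
proof -
  define D M where "D = reservation_wage rt phiU" and "M = break_even_wage rt lam L y yL"
  have surplus: "phiL - phiU = (w - D) / (rt + lam)"
    using employment rt_pos lam_pos by (simp add: employment_eq_iff D_def)
  have piF: "piF = L * (M - w) / (rt + lam)"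
    using firm marginal_job rt_pos lam_pos L_pos by (simp add: marginal_job_eq_iff firm_eq_iff M_def)
  have "D = b + f theta * ((w - D) / (rt + lam))"
    using unemployment surplus by (simp add: unemployment_eq_def D_def reservation_wage_def)
  then have "w = D + Gam * (M - D) \<longleftrightarrow> w = b + Psi * (M - b)"
    using bargained_wage_iff[of "rt + lam" "f theta" Gam D b w M] rt_pos lam_pos f_pos Gam Psi_def
    by (simp flip: rt_def)
  \<comment> \<open>For the converse: nonnegative payoffs place \<open>w\<close> itself between
    \<open>D\<close> and \<open>M\<close>, so the set of agreements is nonempty.\<close>
  moreover have "D \<le> M" if "0 \<le> L * (phiL - phiU)" "0 \<le> piF"
  proof -
    have "D \<le> w" "w \<le> M"
      using that rt_pos lam_pos L_pos
      by (auto simp: surplus piF zero_le_mult_iff zero_le_divide_iff)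
    then show ?thesis
      by simp
  qed
  moreover have "M - b = yL - b + (rt + lam) / rt * (yhat - yL)"
    by (simp add: M_def break_even_wage_def yhat_def)
  moreover note collective_bargaining_wage_iff[OF rt_pos lam_pos L_pos Gam D_def M_def]
  ultimately show ?thesis
    unfolding rt_def[symmetric] by auto
qed

end
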